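(* The generating function $D_3(x)=\sum_{n\ge 0} d_n^{\#3}x^n$ of the sequence $\{d_n^{\#3}\}_{n\geq0}$ is $$D_3(x)= \frac{-5+3\sqrt{1-8x}+3\sqrt{3-4x-2\sqrt{1-8x}}+4x-\sqrt{1-8x}\,\sqrt{3-4x-2\sqrt{1-8x}}}{4}.$$
   Context: The m-implication of type 1 is the connective $\psi\rightharpoonup\phi\equiv\psi\to\neg\phi$, which has value 0 (false) exactly when $\psi$ and $\phi$ both have value 1 (true), and value 1 otherwise. A bracketed formula with $n$ distinct variables is obtained from $p_1\rightharpoonup p_2\rightharpoonup\cdots\rightharpoonup p_n$ (variables in this fixed order) by fully inserting brackets; for $n\ge2$ it has the form $\psi\rightharpoonup\phi$ with $\psi$ a bracketing of $p_1\rightharpoonup\cdots\rightharpoonup p_i$ and $\phi$ a bracketing of $p_{i+1}\rightharpoonup\cdots\rightharpoonup p_n$ for some $1\le i\le n-1$. A row is a pair consisting of a bracketed formula and a valuation of $p_1,\dots,p_n$ in $\{0,1\}$. For $n\ge 2$, $d_n^{\#3}$ is the number of rows (over all bracketed formulae in $n$ variables) for which $\psi$ has value 1 and $\phi$ has value 0 (so that $\psi\rightharpoonup\phi$ is true); $d_0^{\#3}=d_1^{\#3}=0$. Square roots denote formal power series with positive constant term. *)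

theory Defs
  imports Complex_Main "HOL-Library.FuncSet" "HOL-Computational_Algebra.Formal_Power_Series"
begin

datatype form = Var nat | MImp form form  (infixr \<open>\<rightharpoonup>\<^sub>1\<close> 60)

primrec vars :: "form \<Rightarrow> nat list" where
  "vars (Var i) = [i]"
| "vars (\<psi> \<rightharpoonup>\<^sub>1 \<phi>) = vars \<psi> @ vars \<phi>"

primrec eval :: "(nat \<Rightarrow> bool) \<Rightarrow> form \<Rightarrow> bool" where
  "eval v (Var i) = v i"
| "eval v (\<psi> \<rightharpoonup>\<^sub>1 \<phi>) = (eval v \<psi> \<longrightarrow> \<not> eval v \<phi>)"

(* A full bracketing of p_1, ..., p_n is a binary tree whose leaves, read from left to right,
   are p_1, ..., p_n. *)
definition bracketed :: "nat \<Rightarrow> form set" where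
  "bracketed n = {\<chi>. vars \<chi> = [1..<Suc n]}"

(* Extensional functions, so that two valuations differ only if they differ on p_1, ..., p_n. *)
definition valuations :: "nat \<Rightarrow> (nat \<Rightarrow> bool) set" where
  "valuations n = {1..n} \<rightarrow>\<^sub>E UNIV"

definition rows :: "nat \<Rightarrow> (form \<times> (nat \<Rightarrow> bool)) set" where
  "rows n = bracketed n \<times> valuations n"

definition d3 :: "nat \<Rightarrow> nat" where
  "d3 n = (if n < 2 then 0
     else card {(\<chi>, v) \<in> rows n. \<exists>\<psi> \<phi>. \<chi> = (\<psi> \<rightharpoonup>\<^sub>1 \<phi>) \<and> eval v \<psi> \<and> \<not> eval v \<phi>})"

definition D3 :: "real fps" where
  "D3 = Abs_fps (\<lambda>n. of_nat (d3 n))"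

definition fps_sqrt :: "real fps \<Rightarrow> real fps" where
  "fps_sqrt f = fps_radical root 2 f"

(* For a positive constant term, fps_sqrt is the square root with positive constant term. *)
lemma fps_sqrt_square:
  assumes "fps_nth f 0 > 0"
  shows "fps_sqrt f ^ 2 = f" and "fps_nth (fps_sqrt f) 0 > 0"
proof -
  show "fps_sqrt f ^ 2 = f"
    using power_radical[of f root 1] assms real_root_pow_pos2[of 2 "fps_nth f 0"]
    by (simp add: fps_sqrt_def flip: numeral_2_eq_2)
  show "fps_nth (fps_sqrt f) 0 > 0"
    using assms by (simp add: fps_sqrt_def numeral_2_eq_2)
qed

lemma length_vars_pos: "length (vars \<chi>) > 0"
  by (induction \<chi>) auto

(* In particular the cardinality in the definition of d3 is that of a finite set. *)
lemma finite_bracketings: "finite {\<chi>. vars \<chi> = xs}"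
proof (induction xs rule: length_induct)
  case (1 xs)
  let ?S = "\<lambda>k. {\<chi>. vars \<chi> = take k xs} \<times> {\<chi>. vars \<chi> = drop k xs}"
  have sub: "{\<chi>. vars \<chi> = xs} \<subseteq>
      Var ` set xs \<union> (\<Union>k\<in>{0<..<length xs}. case_prod MImp ` ?S k)"
  proof
    fix \<chi> assume "\<chi> \<in> {\<chi>. vars \<chi> = xs}"
    then have x: "vars \<chi> = xs" by simp
    show "\<chi> \<in> Var ` set xs \<union> (\<Union>k\<in>{0<..<length xs}. case_prod MImp ` ?S k)"
    proof (cases \<chi>)
      case (Var i)
      then show ?thesis using x by auto
    next
      case (MImp a b)
      then have "length (vars a) \<in> {0<..<length xs}"
        using x length_vars_pos[of a] length_vars_pos[of b] by auto
      moreover have "(a, b) \<in> ?S (length (vars a))" using x MImp by auto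
      ultimately show ?thesis using MImp by force
    qed
  qed
  have *: "finite (?S k)" if "k \<in> {0<..<length xs}" for k
    using that by (intro finite_cartesian_product 1[rule_format]) auto
  have "finite (Var ` set xs \<union> (\<Union>k\<in>{0<..<length xs}. case_prod MImp ` ?S k))"
    by (intro finite_UnI finite_UN_I finite_imageI * finite_set finite_greaterThanLessThan)
  with sub show ?case by (rule finite_subset)
qed

lemma finite_rows: "finite (rows n)"
  by (simp add: rows_def bracketed_def valuations_def finite_bracketings finite_PiE)

end

theory Submission
  imports Defs
begin

text \<open>
  Let \<open>T\<close> and \<open>F\<close> be the generating functions of the true and of the false rows. Splitting a
  formula at its root multiplies the row counts of the two sides, since these share no variable.
  So \<open>F = x + T\<^sup>2\<close>, \<open>T + F = 2 x + (T + F)\<^sup>2\<close> and \<open>D3 = T F\<close>. Completing the square in the first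
  two equations gives \<open>1 - 2 (T + F)\<close> and \<open>1 + 2 T\<close> as the two square roots of the theorem.
\<close>

section \<open>Counting rows by the split at the root\<close>

definition rows_with_value :: "bool \<Rightarrow> nat list \<Rightarrow> (form \<times> (nat \<Rightarrow> bool)) set" where
  "rows_with_value a xs = {(\<chi>, v). vars \<chi> = xs \<and> v \<in> set xs \<rightarrow>\<^sub>E UNIV \<and> eval v \<chi> = a}"

definition split_rows :: "bool \<Rightarrow> bool \<Rightarrow> nat list \<Rightarrow> (form \<times> (nat \<Rightarrow> bool)) set" where
  "split_rows a b xs = {(\<chi>, v). vars \<chi> = xs \<and> v \<in> set xs \<rightarrow>\<^sub>E UNIV \<and>
     (\<exists>\<psi> \<phi>. \<chi> = (\<psi> \<rightharpoonup>\<^sub>1 \<phi>) \<and> eval v \<psi> = a \<and> eval v \<phi> = b)}"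

text \<open>Once k is fixed, the variable lists of the two sides are \<open>take k xs\<close> and
  \<open>drop k xs\<close>. The second is not an initial segment of the variables, so all row sets
  are indexed by a list instead of a number.\<close>

definition split_rows_at :: "nat \<Rightarrow> bool \<Rightarrow> bool \<Rightarrow> nat list \<Rightarrow> (form \<times> (nat \<Rightarrow> bool)) set" where
  "split_rows_at k a b xs = {(\<chi>, v). vars \<chi> = xs \<and> v \<in> set xs \<rightarrow>\<^sub>E UNIV \<and>
     (\<exists>\<psi> \<phi>. \<chi> = (\<psi> \<rightharpoonup>\<^sub>1 \<phi>) \<and> length (vars \<psi>) = k \<and> eval v \<psi> = a \<and> eval v \<phi> = b)}"

lemma finite_row_set: "finite {(\<chi>, v). vars \<chi> = xs \<and> v \<in> set xs \<rightarrow>\<^sub>E (UNIV :: bool set)}"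
proof -
  have "{(\<chi>, v). vars \<chi> = xs \<and> v \<in> set xs \<rightarrow>\<^sub>E (UNIV :: bool set)} =
    {\<chi>. vars \<chi> = xs} \<times> (set xs \<rightarrow>\<^sub>E UNIV)" by auto
  then show ?thesis by (simp add: finite_bracketings finite_PiE)
qed

lemma finite_split_rows: "finite (split_rows a b xs)"
  by (rule finite_subset[OF _ finite_row_set[of xs]]) (auto simp: split_rows_def)

lemma finite_split_rows_at: "finite (split_rows_at k a b xs)"
  by (rule finite_subset[OF _ finite_row_set[of xs]]) (auto simp: split_rows_at_def)

lemma eval_cong:
  assumes "\<And>i. i \<in> set (vars \<chi>) \<Longrightarrow> v i = w i"
  shows "eval v \<chi> = eval w \<chi>"
  using assms by (induction \<chi>) auto

text \<open>The sides have disjoint variables, so a valuation is the same as an independent pair of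
  valuations. No bound on k is assumed: every formula has a variable, so for k = 0 or k \<ge>
  \<open>length xs\<close> both sides are 0.\<close>

lemma card_split_rows_at:
  assumes "distinct xs"
  shows "card (split_rows_at k a b xs) =
    card (rows_with_value a (take k xs)) * card (rows_with_value b (drop k xs))"
proof -
  define A where "A = set (take k xs)"
  define B where "B = set (drop k xs)"
  have AB: "A \<inter> B = {}" "set xs = A \<union> B"
    using assms set_take_disj_set_drop_if_distinct[of xs k k] set_append[of "take k xs" "drop k xs"]
    by (auto simp: A_def B_def)
  define f where "f = (\<lambda>((\<psi>, u), (\<phi>, w)).
    (\<psi> \<rightharpoonup>\<^sub>1 \<phi>, \<lambda>i. if i \<in> A then u i else (w i :: bool)))"
  \<comment> \<open>The \<open>Var\<close> branch is a filler value: \<open>split_rows_at\<close>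
    contains implications only.\<close>
  define g where "g = (\<lambda>(\<chi>, v). case \<chi> of \<psi> \<rightharpoonup>\<^sub>1 \<phi> \<Rightarrow> ((\<psi>, restrict v A), (\<phi>, restrict (v :: nat \<Rightarrow> bool) B))
    | Var i \<Rightarrow> ((\<chi>, v), (\<chi>, v)))"
  have eval_f: "eval (\<lambda>i. if i \<in> A then u i else w i) \<psi> = eval u \<psi>"
    "eval (\<lambda>i. if i \<in> A then u i else w i) \<phi> = eval w \<phi>"
    if "set (vars \<psi>) = A" "set (vars \<phi>) = B" for \<psi> \<phi> u w
    using that AB(1) by (intro eval_cong; auto)+
  have eval_g: "eval (restrict v A) \<psi> = eval v \<psi>" "eval (restrict v B) \<phi> = eval v \<phi>"
    if "set (vars \<psi>) = A" "set (vars \<phi>) = B" for \<psi> \<phi> v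
    using that by (intro eval_cong; auto)+
  have split: "vars \<psi> = take k xs" "vars \<phi> = drop k xs"
    if "vars (\<psi> \<rightharpoonup>\<^sub>1 \<phi>) = xs" "length (vars \<psi>) = k" for \<psi> \<phi>
    using that by auto
  have "bij_betw f (rows_with_value a (take k xs) \<times> rows_with_value b (drop k xs)) (split_rows_at k a b xs)"
  proof (rule bij_betw_byWitness[where f' = g])
    \<comment> \<open>Restriction recovers \<open>u\<close> and \<open>w\<close> as functions
      because both are extensional, hence \<open>undefined\<close> off \<open>A\<close> and
      \<open>B\<close>.\<close>
    show "\<forall>p\<in>rows_with_value a (take k xs) \<times> rows_with_value b (drop k xs). g (f p) = p"
      using AB(1) by (auto simp: rows_with_value_def f_def g_def A_def[symmetric] B_def[symmetric]
        restrict_def PiE_def extensional_def fun_eq_iff)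
    show "\<forall>q\<in>split_rows_at k a b xs. f (g q) = q"
      using AB(2) by (auto simp: split_rows_at_def f_def g_def
        restrict_def PiE_def extensional_def fun_eq_iff)
    show "f ` (rows_with_value a (take k xs) \<times> rows_with_value b (drop k xs)) \<subseteq> split_rows_at k a b xs"
    proof
      fix q assume "q \<in> f ` (rows_with_value a (take k xs) \<times> rows_with_value b (drop k xs))"
      then obtain \<psi> \<phi> u w where h: "q = (\<psi> \<rightharpoonup>\<^sub>1 \<phi>, \<lambda>i. if i \<in> A then u i else w i)"
        "vars \<psi> = take k xs" "vars \<phi> = drop k xs" "w \<in> B \<rightarrow>\<^sub>E UNIV" "eval u \<psi> = a" "eval w \<phi> = b"
        by (auto simp: rows_with_value_def f_def B_def)
      have "(\<lambda>i. if i \<in> A then u i else w i) \<in> set xs \<rightarrow>\<^sub>E UNIV"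
        using h(4) AB(2) by (auto simp: PiE_def extensional_def)
      moreover have "set (vars \<psi>) = A" "set (vars \<phi>) = B" using h by (auto simp: A_def B_def)
      note eval_f[OF this]
      \<comment> \<open>\<open>take k xs\<close> has length k only if k \<le>
        \<open>length xs\<close>; this holds as \<open>drop k xs\<close> lists the variables of
        \<phi> and is nonempty.\<close>
      moreover have "length (vars \<psi>) = k" using h(2,3) length_vars_pos[of \<phi>] by simp
      ultimately show "q \<in> split_rows_at k a b xs" using h by (simp add: split_rows_at_def)
    qed
    show "g ` split_rows_at k a b xs \<subseteq> rows_with_value a (take k xs) \<times> rows_with_value b (drop k xs)"
    proof
      fix p assume "p \<in> g ` split_rows_at k a b xs"
      then obtain \<psi> \<phi> v where h: "p = ((\<psi>, restrict v A), (\<phi>, restrict v B))"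
        "vars (\<psi> \<rightharpoonup>\<^sub>1 \<phi>) = xs" "length (vars \<psi>) = k" "eval v \<psi> = a" "eval v \<phi> = b"
        by (auto simp: split_rows_at_def g_def)
      note s = split[OF h(2,3)]
      have "set (vars \<psi>) = A" "set (vars \<phi>) = B" using s by (auto simp: A_def B_def)
      note e = eval_g[OF this]
      show "p \<in> rows_with_value a (take k xs) \<times> rows_with_value b (drop k xs)"
        using h(1,4,5) s e by (simp add: rows_with_value_def A_def[symmetric] B_def[symmetric])
    qed
  qed
  then show ?thesis by (metis bij_betw_same_card card_cartesian_product)
qed

lemma card_split_rows:
  assumes "distinct xs"
  shows "card (split_rows a b xs) =
    (\<Sum>k\<in>{0<..<length xs}. card (rows_with_value a (take k xs)) * card (rows_with_value b (drop k xs)))"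
proof -
  have "split_rows a b xs = (\<Union>k\<in>{0<..<length xs}. split_rows_at k a b xs)"
    using length_vars_pos by (force simp: split_rows_def split_rows_at_def)
  then have "card (split_rows a b xs) = (\<Sum>k\<in>{0<..<length xs}. card (split_rows_at k a b xs))"
    \<comment> \<open>The sets for different k are disjoint because the formula determines its left
      side and hence k.\<close>
    by (simp, subst card_UN_disjoint) (auto simp: finite_split_rows_at, auto simp: split_rows_at_def)
  then show ?thesis by (simp add: card_split_rows_at[OF assms])
qed

section \<open>Recursion and base cases for true and false rows\<close>

lemma length_ge_2_MImp:
  assumes "length (vars \<chi>) \<ge> 2" obtains \<psi> \<phi> where "\<chi> = (\<psi> \<rightharpoonup>\<^sub>1 \<phi>)"
  using assms by (cases \<chi>) auto

lemma card_rows_with_value_False: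
  assumes "length xs \<ge> 2"
  shows "card (rows_with_value False xs) = card (split_rows True True xs)"
proof -
  have "rows_with_value False xs = split_rows True True xs"
    using assms by (auto simp: rows_with_value_def split_rows_def elim!: length_ge_2_MImp)
  then show ?thesis by simp
qed

lemma card_rows_with_value_True:
  assumes "length xs \<ge> 2"
  shows "card (rows_with_value True xs) = card (split_rows True False xs)
    + card (split_rows False True xs) + card (split_rows False False xs)"
proof -
  have "rows_with_value True xs =
      split_rows True False xs \<union> split_rows False True xs \<union> split_rows False False xs"
    using assms by (auto simp: rows_with_value_def split_rows_def elim!: length_ge_2_MImp)
  moreover have "split_rows True False xs \<inter> split_rows False True xs = {}"
    "(split_rows True False xs \<union> split_rows False True xs) \<inter> split_rows False False xs = {}"
    by (auto simp: split_rows_def)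
  ultimately show ?thesis by (simp add: finite_split_rows card_Un_disjoint)
qed

lemma rows_with_value_Nil: "rows_with_value a [] = {}"
  using length_vars_pos by (fastforce simp: rows_with_value_def)

lemma card_rows_with_value_singleton: "card (rows_with_value a [i]) = 1"
proof -
  have "vars \<chi> = [i] \<longleftrightarrow> \<chi> = Var i" for \<chi>
  proof (cases \<chi>)
    case (MImp \<psi> \<phi>)
    then show ?thesis
      using length_vars_pos[of \<psi>] length_vars_pos[of \<phi>] by (auto simp: append_eq_Cons_conv)
  qed auto
  then have "rows_with_value a [i] = (\<lambda>v. (Var i, v)) ` {v \<in> {i} \<rightarrow>\<^sub>E UNIV. v i = a}"
    by (auto simp: rows_with_value_def)
  \<comment> \<open>Extensionality leaves one valuation on a single variable with the value
    \<open>a\<close>.\<close>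
  also have "{v \<in> {i} \<rightarrow>\<^sub>E UNIV. v i = a} = {\<lambda>j\<in>{i}. a}"
  proof (intro equalityI subsetI)
    fix v :: "nat \<Rightarrow> bool" assume v: "v \<in> {v \<in> {i} \<rightarrow>\<^sub>E UNIV. v i = a}"
    then have "v = (\<lambda>j\<in>{i}. a)" by (intro extensionalityI[of _ "{i}"]) (auto simp: PiE_def)
    then show "v \<in> {\<lambda>j\<in>{i}. a}" by simp
  qed auto
  finally show ?thesis by simp
qed

text \<open>Variable names do not matter. Strong induction through the root split avoids an explicit
  renaming bijection: the recursion refers only to shorter pieces of the lists, of equal
  lengths.\<close>

lemma card_rows_with_value_length_cong:
  assumes "distinct xs" "distinct ys" "length xs = length ys"
  shows "card (rows_with_value a xs) = card (rows_with_value a ys)"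
  using assms
proof (induction xs arbitrary: a ys rule: length_induct)
  case (1 xs)
  consider "xs = []" | i where "xs = [i]" | "length xs \<ge> 2"
    \<comment> \<open>This rule is borrowed for its case split into empty, singleton and longer
      lists.\<close>
    by (cases xs rule: remdups_adj.cases) auto
  then show ?case
  proof cases
    case 1
    with "1.prems" show ?thesis by simp
  next
    case 2
    with "1.prems" obtain j where "ys = [j]" by (cases ys) auto
    with 2 show ?thesis by (simp add: card_rows_with_value_singleton)
  next
    case 3
    have "card (rows_with_value a' (take k xs)) = card (rows_with_value a' (take k ys))"
      "card (rows_with_value a' (drop k xs)) = card (rows_with_value a' (drop k ys))"
      if "k \<in> {0<..<length xs}" for k a'
      using that "1.prems" by (auto intro!: "1.IH"[rule_format])
    then have "card (split_rows a' b xs) = card (split_rows a' b ys)" for a' b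
      using "1.prems" by (simp add: card_split_rows)
    then show ?thesis
      using 3 "1.prems" by (cases a) (simp_all add: card_rows_with_value_True card_rows_with_value_False)
  qed
qed

section \<open>Generating functions of the row counts\<close>

definition row_count :: "bool \<Rightarrow> nat \<Rightarrow> nat" where
  "row_count a n = card (rows_with_value a [0..<n])"

lemma card_rows_with_value_eq:
  "distinct xs \<Longrightarrow> card (rows_with_value a xs) = row_count a (length xs)"
  unfolding row_count_def by (rule card_rows_with_value_length_cong) auto

lemma row_count_0: "row_count a 0 = 0"
  by (simp add: row_count_def rows_with_value_Nil)

lemma row_count_1: "row_count a (Suc 0) = 1"
  by (simp add: row_count_def card_rows_with_value_singleton)

definition row_fps :: "bool \<Rightarrow> real fps" where
  "row_fps a = Abs_fps (\<lambda>n. of_nat (row_count a n))"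

lemma row_fps_nth: "fps_nth (row_fps a) n = of_nat (row_count a n)"
  by (simp add: row_fps_def)

lemma card_split_rows_fps:
  assumes "distinct xs"
  shows "of_nat (card (split_rows a b xs)) = fps_nth (row_fps a * row_fps b) (length xs)"
proof -
  let ?n = "length xs"
  have "card (split_rows a b xs) = (\<Sum>k\<in>{0<..<?n}. row_count a k * row_count b (?n - k))"
    using assms by (simp add: card_split_rows card_rows_with_value_eq min_def)
  \<comment> \<open>Adding the end terms, which vanish by \<open>row_count_0\<close>, turns the sum
    into a Cauchy product.\<close>
  also have "\<dots> = (\<Sum>k\<in>{0..?n}. row_count a k * row_count b (?n - k))"
  proof (rule sum.mono_neutral_left)
    show "\<forall>k\<in>{0..?n} - {0<..<?n}. row_count a k * row_count b (?n - k) = 0"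
      by (auto simp: row_count_0 not_less)
  qed auto
  finally show ?thesis by (simp add: row_fps_nth fps_mult_nth)
qed

text \<open>Both factors have constant term 0, so the product starts at degree 2. This settles the
  degrees in which no formula has a root split.\<close>

lemma row_fps_mult_nth_less_2:
  assumes "n < 2" shows "fps_nth (row_fps a * row_fps b) n = 0"
  using assms by (auto simp: fps_mult_nth row_fps_nth row_count_0 less_2_cases_iff)

text \<open>The term \<open>fps_X\<close> is the false row of a single variable; the product counts
  implications with both sides true.\<close>

lemma row_fps_False: "row_fps False = fps_X + row_fps True * row_fps True"
proof (rule fps_ext)
  fix n
  consider "n = 0" | "n = Suc 0" | "n \<ge> 2" by linarith
  then show "fps_nth (row_fps False) n = fps_nth (fps_X + row_fps True * row_fps True) n"
  proof cases
    case 3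
    then show ?thesis
      using card_split_rows_fps[of "[0..<n]" True True] card_rows_with_value_False[of "[0..<n]"]
      by (simp add: row_fps_nth row_count_def fps_X_def)
  qed (simp_all add: row_fps_mult_nth_less_2, simp_all add: row_fps_nth row_count_0 row_count_1)
qed

lemma row_fps_True: "row_fps True = fps_X + 2 * (row_fps True * row_fps False)
  + row_fps False * row_fps False"
proof (rule fps_ext)
  fix n
  have two: "fps_nth (2 * g) n = 2 * fps_nth g n" for g :: "real fps"
    by (simp only: mult_2 fps_add_nth)
  consider "n = 0" | "n = Suc 0" | "n \<ge> 2" by linarith
  then show "fps_nth (row_fps True) n = fps_nth (fps_X + 2 * (row_fps True * row_fps False)
    + row_fps False * row_fps False) n"
  proof cases
    case 3
    then show ?thesis
      using card_split_rows_fps[of "[0..<n]" True False] card_split_rows_fps[of "[0..<n]" False True]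
        card_split_rows_fps[of "[0..<n]" False False] card_rows_with_value_True[of "[0..<n]"]
      by (simp add: row_fps_nth row_count_def fps_X_def two mult.commute[of "row_fps False" "row_fps True"])
  qed (simp_all add: two row_fps_mult_nth_less_2, simp_all add: row_fps_nth row_count_0 row_count_1)
qed

lemma D3_eq: "D3 = row_fps True * row_fps False"
proof (rule fps_ext)
  fix n
  show "fps_nth D3 n = fps_nth (row_fps True * row_fps False) n"
  proof (cases "n < 2")
    case True
    then show ?thesis by (simp add: D3_def d3_def row_fps_mult_nth_less_2)
  next
    case False
    \<comment> \<open>The variables start at 1 here and at 0 in \<open>row_count\<close>; only the
      length n of the list enters the count.\<close>
    have "{(\<chi>, v) \<in> rows n. \<exists>\<psi> \<phi>. \<chi> = (\<psi> \<rightharpoonup>\<^sub>1 \<phi>) \<and> eval v \<psi> \<and> \<not> eval v \<phi>} =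
        split_rows True False [1..<Suc n]"
      by (auto simp: rows_def bracketed_def valuations_def split_rows_def atLeastLessThanSuc_atLeastAtMost
        simp del: upt_Suc)
    with False show ?thesis
      using card_split_rows_fps[of "[1..<Suc n]" True False]
      by (simp add: D3_def d3_def del: upt_Suc)
  qed
qed

section \<open>Square roots and the closed form\<close>

lemma fps_sqrt_unique:
  assumes "g ^ 2 = f" "fps_nth g 0 > 0"
  shows "fps_sqrt f = g"
proof -
  have "fps_nth f 0 > 0" using assms(2) by (simp add: assms(1)[symmetric] fps_power_zeroth)
  note s = fps_sqrt_square[OF this]
  \<comment> \<open>Real power series form an integral domain, so two roots differ at most in sign;
    the constant terms then exclude \<open>- g\<close>.\<close>
  have "fps_sqrt f = g \<or> fps_sqrt f = - g"
    using s(1) assms(1) power2_eq_iff by metis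
  then show ?thesis using s(2) assms(2) by auto
qed

theorem proposition6p4:
  shows "D3 =
    (- 5 + 3 * fps_sqrt (1 - 8 * fps_X)
      + 3 * fps_sqrt (3 - 4 * fps_X - 2 * fps_sqrt (1 - 8 * fps_X))
      + 4 * fps_X
      - fps_sqrt (1 - 8 * fps_X) * fps_sqrt (3 - 4 * fps_X - 2 * fps_sqrt (1 - 8 * fps_X))) / 4"
proof -
  define T where "T = row_fps True"
  define F where "F = row_fps False"
  have F: "F = fps_X + T * T" and T: "T = fps_X + 2 * (T * F) + F * F"
    unfolding T_def F_def by (rule row_fps_False, rule row_fps_True)
  have TF0: "fps_nth T 0 = 0" "fps_nth F 0 = 0"
    by (simp_all add: T_def F_def row_fps_nth row_count_0)
  \<comment> \<open>For S = T + F, adding the two equations gives S = 2 x + S^2, hence (1 - 2 S)^2 =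
    1 - 4 S + 4 S^2 = 1 - 8 x.\<close>
  have s: "fps_sqrt (1 - 8 * fps_X) = 1 - 2 * (T + F)"
  proof (rule fps_sqrt_unique)
    show "(1 - 2 * (T + F)) ^ 2 = 1 - 8 * fps_X"
    proof -
      have "(1 - 2 * (T + F)) ^ 2 = 1 - 4 * (T + F) + 4 * (T * T + 2 * (T * F) + F * F)"
        by (simp add: power2_eq_square algebra_simps)
      also have "T * T + 2 * (T * F) + F * F = T + F - 2 * fps_X"
        using F T by (simp add: algebra_simps)
      finally show ?thesis by (simp add: algebra_simps)
    qed
  qed (simp add: TF0 fps_mult_nth)
  \<comment> \<open>The radicand equals 1 + 4 T + 4 (F - x), and F - x = T^2 makes it a perfect
    square.\<close>
  have r: "fps_sqrt (3 - 4 * fps_X - 2 * (1 - 2 * (T + F))) = 1 + 2 * T"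
  proof (rule fps_sqrt_unique)
    show "(1 + 2 * T) ^ 2 = 3 - 4 * fps_X - 2 * (1 - 2 * (T + F))"
      by (simp add: F power2_eq_square algebra_simps)
  qed (simp add: TF0 fps_mult_nth)
  \<comment> \<open>Expanding leaves 4 (x + T^2 - F) + 4 T F, whose first summand is 0.\<close>
  have "- 5 + 3 * (1 - 2 * (T + F)) + 3 * (1 + 2 * T) + 4 * fps_X
      - (1 - 2 * (T + F)) * (1 + 2 * T) = 4 * D3"
    unfolding D3_eq T_def[symmetric] F_def[symmetric] by (simp add: F algebra_simps)
  then show ?thesis unfolding s r by (simp only:) simp
qed

end
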